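(* Let $1<s<q<p\le N$. Assume there are constants $\rho_0>0$ and $\gamma>p-1$ such that $\rho(x)\ge \rho_0(1+x_N)^\gamma$ for a.e. $x\in\mathbb{R}^N_+$. Suppose that $b\in\mathcal{K}_b\cap L^1(\mathbb{R}^N_+)$, let $b_0>0$ be a constant such that $b(x)(1+x_N)^{p-\gamma}\le b_0$ in $\mathbb{R}^N_+$, and suppose that $a/b\in L^\infty(\mathbb{R}^N_+)$ with $$\left\|\frac{a}{b}\right\|_{\infty}^{p-s}\left(\frac{b_0\,C_{p,\gamma}^{-p}}{\rho_0}\right)^{q-s}<\frac{(p-s)^{p-s}}{(q-s)^{q-s}(p-q)^{p-q}},\qquad C_{p,\gamma}=\frac{\gamma-p+1}{p}.$$ Then the problem $$-\mathrm{div}(\rho(x)|\nabla u|^{p-2}\nabla u)=a(x)|u|^{q-2}u-b(x)|u|^{s-2}u \ \text{ in } \mathbb{R}^N_+,\qquad |\nabla u|^{p-2}\nabla u\cdot\nu=0\ \text{ on } \mathbb{R}^{N-1},$$ possesses only the trivial weak solution $u=0$ in $E$.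
   Context: $\mathbb{R}^N_+=\{(x',x_N): x'\in\mathbb{R}^{N-1},\ x_N>0\}$, with boundary identified with $\mathbb{R}^{N-1}$ and unit outer normal $\nu$. The functions $\rho,a,b$ are positive and integrable on every bounded subset of $\mathbb{R}^N_+$. $C_\delta^\infty(\mathbb{R}^N_+)$ is the set of restrictions to $\mathbb{R}^N_+$ of functions in $C_0^\infty(\mathbb{R}^N)$ (smooth, compactly supported). $E$ is the completion (closure) of $C_\delta^\infty(\mathbb{R}^N_+)$ with respect to $\|u\|=\left(\int_{\mathbb{R}^N_+}\rho|\nabla u|^p\,dx\right)^{1/p}$; under the lower bound on $\rho$ it is identified with a space of weakly differentiable functions in $L^p(\mathbb{R}^N_+,(1+x_N)^{\gamma-p}dx)$. $\mathcal{K}_b=\{k\in C(\overline{\mathbb{R}^N_+},(0,\infty)): k(x)(1+x_N)^{p-\gamma}\in L^\infty(\mathbb{R}^N_+)\}$. A weak solution of the problem is a function $u\in E$ such that $$\int_{\mathbb{R}^N_+}\rho|\nabla u|^{p-2}\nabla u\cdot\nabla\varphi\,dx=\int_{\mathbb{R}^N_+}\left(a|u|^{q-2}u-b|u|^{s-2}u\right)\varphi\,dx\quad\text{for every }\varphi\in C_\delta^\infty(\mathbb{R}^N_+).$$ *)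

theory Defs
  imports "HOL-Analysis.Analysis" "HOL-Probability.Essential_Supremum"
begin

text \<open>Points of R^N are pairs (x', x_N) with x' in R^(N-1), so that N = CARD('m) + 1.
  The product norm and inner product are the Euclidean ones.\<close>

type_synonym 'm pt = "(real ^ 'm) \<times> real"

definition halfspace :: "('m::finite) pt set" where
  "halfspace = {x. snd x > 0}"

abbreviation half_leb :: "('m::finite) pt measure" where
  "half_leb \<equiv> lebesgue_on halfspace"

primrec Ck :: "nat \<Rightarrow> ('a::euclidean_space \<Rightarrow> real) \<Rightarrow> bool" where
  "Ck 0 f \<longleftrightarrow> continuous_on UNIV f"
| "Ck (Suc k) f \<longleftrightarrow> (\<forall>x. f differentiable (at x)) \<and>
     (\<forall>i\<in>Basis. Ck k (\<lambda>x. frechet_derivative f (at x) i))"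

definition smooth :: "('a::euclidean_space \<Rightarrow> real) \<Rightarrow> bool" where
  "smooth f \<longleftrightarrow> (\<forall>k. Ck k f)"

definition grad :: "('a::euclidean_space \<Rightarrow> real) \<Rightarrow> 'a \<Rightarrow> 'a" where
  "grad f x = (\<Sum>i\<in>Basis. frechet_derivative f (at x) i *\<^sub>R i)"

definition Cc_infty :: "'a::euclidean_space set \<Rightarrow> ('a \<Rightarrow> real) set" where
  "Cc_infty \<Omega> = {f. smooth f \<and> compact (closure {x. f x \<noteq> 0}) \<and> closure {x. f x \<noteq> 0} \<subseteq> \<Omega>}"

text \<open>Functions on the half-space are total functions whose values off the half-space
  are irrelevant (also for grad, as the half-space is open).\<close>

definition C_delta :: "(('m::finite) pt \<Rightarrow> real) set" where
  "C_delta = {\<phi>. \<exists>\<psi>\<in>Cc_infty UNIV. \<forall>x\<in>halfspace. \<phi> x = \<psi> x}"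

definition weight_fun :: "(('m::finite) pt \<Rightarrow> real) \<Rightarrow> bool" where
  "weight_fun f \<longleftrightarrow> (AE x in half_leb. 0 < f x) \<and>
     (\<forall>S\<in>sets lebesgue. bounded S \<and> S \<subseteq> halfspace \<longrightarrow> set_integrable lebesgue S f)"

definition Linfty_norm :: "'a measure \<Rightarrow> ('a \<Rightarrow> real) \<Rightarrow> ereal" where
  "Linfty_norm M f = esssup M (\<lambda>x. ereal \<bar>f x\<bar>)"

definition in_Linfty :: "'a measure \<Rightarrow> ('a \<Rightarrow> real) \<Rightarrow> bool" where
  "in_Linfty M f \<longleftrightarrow> f \<in> borel_measurable M \<and> Linfty_norm M f < \<infinity>"

definition K_b :: "real \<Rightarrow> real \<Rightarrow> (('m::finite) pt \<Rightarrow> real) set" where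
  "K_b p \<gamma> = {k. continuous_on (closure halfspace) k \<and> (\<forall>x\<in>closure halfspace. 0 < k x) \<and>
     in_Linfty half_leb (\<lambda>x. k x * (1 + snd x) powr (p - \<gamma>))}"

text \<open>The weighted Lebesgue space of scalar or vector valued functions on the half-space.\<close>

definition wLp :: "real \<Rightarrow> (('m::finite) pt \<Rightarrow> real) \<Rightarrow> ('m pt \<Rightarrow> 'b::euclidean_space) set" where
  "wLp p w = {f. f \<in> borel_measurable half_leb \<and>
     integrable half_leb (\<lambda>x. w x * norm (f x) powr p)}"

definition wnorm ::
    "real \<Rightarrow> (('m::finite) pt \<Rightarrow> real) \<Rightarrow> ('m pt \<Rightarrow> 'b::euclidean_space) \<Rightarrow> real" where
  "wnorm p w f = (\<integral>x. w x * norm (f x) powr p \<partial>half_leb) powr (1 / p)"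

definition loc_integrable :: "(('m::finite) pt \<Rightarrow> 'b::euclidean_space) \<Rightarrow> bool" where
  "loc_integrable f \<longleftrightarrow> (\<forall>K. compact K \<and> K \<subseteq> halfspace \<longrightarrow> set_integrable lebesgue K f)"

definition weak_gradient :: "(('m::finite) pt \<Rightarrow> real) \<Rightarrow> ('m pt \<Rightarrow> 'm pt) \<Rightarrow> bool" where
  "weak_gradient u G \<longleftrightarrow> loc_integrable u \<and> loc_integrable G \<and>
     (\<forall>\<phi>\<in>Cc_infty halfspace.
        (\<integral>x. u x *\<^sub>R grad \<phi> x \<partial>half_leb) = - (\<integral>x. \<phi> x *\<^sub>R G x \<partial>half_leb))"

text \<open>The completion E of C_delta for the norm (integral of rho |grad u|^p)^(1/p).
  By Hardy's inequality a Cauchy sequence for that norm converges in the weighted space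
  L^p((1 + x_N)^(gamma - p) dx), while its gradients converge in L^p(rho dx); a point of the
  completion is identified with the first limit u, and the second limit is then the weak
  gradient of u. Thus E consists of the pairs (u, G), G being the (almost everywhere unique)
  weak gradient of u, that are limits of pairs (phi, grad phi) with phi in C_delta.\<close>

definition space_E ::
    "(('m::finite) pt \<Rightarrow> real) \<Rightarrow> real \<Rightarrow> real \<Rightarrow> (('m pt \<Rightarrow> real) \<times> ('m pt \<Rightarrow> 'm pt)) set" where
  "space_E \<rho> p \<gamma> = {(u, G).
     u \<in> wLp p (\<lambda>x. (1 + snd x) powr (\<gamma> - p)) \<and> G \<in> wLp p \<rho> \<and> weak_gradient u G \<and>
     (\<exists>\<phi>. (\<forall>n::nat. \<phi> n \<in> C_delta) \<and>
        (\<lambda>n. wnorm p \<rho> (\<lambda>x. grad (\<phi> n) x - G x)) \<longlonglongrightarrow> 0 \<and>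
        (\<lambda>n. wnorm p (\<lambda>x. (1 + snd x) powr (\<gamma> - p)) (\<lambda>x. \<phi> n x - u x)) \<longlonglongrightarrow> 0)}"

text \<open>Weak form of -div(rho |Du|^(p-2) Du) = a |u|^(q-2) u - b |u|^(s-2) u in the half-space
  with |Du|^(p-2) Du . nu = 0 on its boundary: the test functions need not vanish there.
  The convention 0 powr t = 0 makes the terms vanish where Du or u does, also for exponents
  below 2.\<close>

definition weak_solution ::
    "real \<Rightarrow> real \<Rightarrow> real \<Rightarrow> real \<Rightarrow> (('m::finite) pt \<Rightarrow> real) \<Rightarrow> ('m pt \<Rightarrow> real) \<Rightarrow>
     ('m pt \<Rightarrow> real) \<Rightarrow> ('m pt \<Rightarrow> real) \<Rightarrow> bool" where
  "weak_solution p q s \<gamma> \<rho> a b u \<longleftrightarrow>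
     (\<exists>G. (u, G) \<in> space_E \<rho> p \<gamma> \<and>
       (\<forall>\<phi>\<in>C_delta.
          (\<integral>x. \<rho> x * norm (G x) powr (p - 2) * (G x \<bullet> grad \<phi> x) \<partial>half_leb) =
          (\<integral>x. (a x * \<bar>u x\<bar> powr (q - 2) * u x - b x * \<bar>u x\<bar> powr (s - 2) * u x) * \<phi> x
             \<partial>half_leb)))"

end

theory Submission
  imports Defs
begin

text \<open>Testing the equation with the approximating functions of u and passing to the limit gives the
  energy identity I = \<integral> a|u|^q - b|u|^s with I = \<integral> \<rho>|Du|^p. By Young's inequality
  A t^q - t^s \<le> \<Lambda> t^p with an optimal constant \<Lambda> depending on A = ||a/b||, so
  I \<le> \<Lambda> \<integral> b|u|^p \<le> \<Lambda> b0 \<integral> (1 + x_N)^(\<gamma> - p) |u|^p. A weighted Hardy inequality bounds the last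
  integral by I / (C^p \<rho>0), and the smallness condition says exactly that
  \<Lambda> b0 / (C^p \<rho>0) < 1. Hence I = 0, and u = 0 by the Hardy inequality again.\<close>

section \<open>Elementary inequalities\<close>

text \<open>A solution is not itself an admissible test function, so norm convergence of the
  approximants has to be turned into convergence of nonlinear integrals. Both source terms are
  dominated by a multiple of b (1 + |u|)^(p - 1): the Hardy weight controls b |u|^p, and the
  integrability of \<open>b\<close> pays for the summand 1, which absorbs the lower powers q - 1 and
  s - 1.

  Hoelder and Minkowski are replaced by pointwise Young and convexity inequalities with a free
  parameter. The sequence index goes to infinity first, with the parameter fixed; only then does the
  parameter go to 0, so constants that blow up with it are harmless.

  The Hardy inequality is one-dimensional, along the lines in direction x_N. Test functions may be
  nonzero at x_N = 0, but the boundary term there has the favourable sign; \<gamma> > p - 1 makes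
  the exponent \<gamma> - p + 1 of the auxiliary weight, and hence the Hardy constant,
  positive.\<close>

lemma young_powr:
  fixes x y c p :: real
  assumes "0 < c" "1 < p" "0 \<le> x" "0 \<le> y"
  shows "x powr (p - 1) * y \<le> c * ((p - 1) / p) * x powr p + c powr (1 - p) / p * y powr p"
proof (cases "x = 0 \<or> y = 0")
  case True
  then show ?thesis using assms by auto
next
  case False
  then have pos: "0 < x" "0 < y" using assms by auto
  \<comment> \<open>Weighted AM-GM with weights (p - 1)/p and 1/p. The scalings c and c^(1 - p) are
    matched so that c cancels on the left while staying free on the right.\<close>
  have "(c * x powr p) powr ((p - 1) / p) * (c powr (1 - p) * y powr p) powr (1 / p)
      \<le> (p - 1) / p * (c * x powr p) + 1 / p * (c powr (1 - p) * y powr p)"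
    using assms pos by (intro Youngs_inequality_0) (auto simp: field_simps)
  moreover have "(c * x powr p) powr ((p - 1) / p) = c powr ((p - 1) / p) * x powr (p - 1)"
    using assms pos by (simp add: powr_mult powr_powr)
  moreover have "(c powr (1 - p) * y powr p) powr (1 / p) = c powr ((1 - p) / p) * y"
    using assms pos by (simp add: powr_mult powr_powr)
  moreover have "c powr ((p - 1) / p) * c powr ((1 - p) / p) = 1"
    using assms by (simp add: diff_divide_distrib flip: powr_add)
  ultimately show ?thesis
    by (simp add: algebra_simps mult.left_commute[of _ "c powr ((1 - p) / p)"])
qed

text \<open>Convexity of t^p at x + y = (1 - l) (x / (1 - l)) + l (y / l). The factor of x^p tends
  to 1 as l tends to 0, which keeps constants sharp in limits; l = 1/2 suffices for mere
  integrability.\<close>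

lemma add_powr_le:
  fixes x y l p :: real
  assumes "0 < l" "l < 1" "1 < p" "0 \<le> x" "0 \<le> y"
  shows "(x + y) powr p \<le> (1 - l) powr (1 - p) * x powr p + l powr (1 - p) * y powr p"
proof (cases "x = 0 \<or> y = 0")
  case True
  have "1 \<le> (1 - l) powr (1 - p)" "1 \<le> l powr (1 - p)"
    using assms by (simp_all add: powr_def mult_nonpos_nonpos)
  then show ?thesis
    using True assms mult_right_mono[of 1 "(1 - l) powr (1 - p)" "x powr p"]
      mult_right_mono[of 1 "l powr (1 - p)" "y powr p"] by auto
next
  case False
  then have pos: "0 < x" "0 < y" using assms by auto
  have "((1 - l) *\<^sub>R (x / (1 - l)) + l *\<^sub>R (y / l)) powr p
      \<le> (1 - l) * (x / (1 - l)) powr p + l * (y / l) powr p"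
    using assms pos powr_convex[of p] by (intro convex_onD) auto
  moreover have "(1 - l) * (x / (1 - l)) powr p = (1 - l) powr (1 - p) * x powr p"
    using assms pos by (simp add: powr_divide powr_diff)
  moreover have "l * (y / l) powr p = l powr (1 - p) * y powr p"
    using assms pos by (simp add: powr_divide powr_diff)
  ultimately show ?thesis
    using assms by simp
qed

lemma norm_powr_le:
  fixes x y :: "'a::real_normed_vector"
  assumes "0 < l" "l < 1" "1 < p"
  shows "norm x powr p \<le> (1 - l) powr (1 - p) * norm y powr p + l powr (1 - p) * norm (x - y) powr p"
proof -
  have "norm x powr p \<le> (norm y + norm (x - y)) powr p"
    using assms norm_triangle_sub[of x y] by (intro powr_mono2) auto
  also have "\<dots> \<le> (1 - l) powr (1 - p) * norm y powr p + l powr (1 - p) * norm (x - y) powr p"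
    using assms by (intro add_powr_le) auto
  finally show ?thesis .
qed

text \<open>The point x = 0 is included because p > 1; the Hardy argument differentiates |f|^p also
  at zeros of f.\<close>

lemma has_real_derivative_abs_powr:
  fixes x p :: real
  assumes "1 < p"
  shows "((\<lambda>x. \<bar>x\<bar> powr p) has_real_derivative p * \<bar>x\<bar> powr (p - 1) * sgn x) (at x)"
proof (cases "x = 0")
  case False
  have "(abs has_real_derivative sgn x) (at x)"
  proof (rule has_field_derivative_transform_within_open)
    show "((\<lambda>y. sgn x * y) has_real_derivative sgn x) (at x)"
      by (auto intro!: derivative_eq_intros)
    show "open {y. 0 < sgn x * y}" by (intro open_Collect_less continuous_intros)
    show "x \<in> {y. 0 < sgn x * y}" using False by (auto simp: sgn_if)
    show "sgn x * y = \<bar>y\<bar>" if "y \<in> {y. 0 < sgn x * y}" for y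
      using that False by (auto simp: sgn_if split: if_splits)
  qed
  then have "((\<lambda>x. \<bar>x\<bar> powr p) has_real_derivative (p * \<bar>x\<bar> powr (p - 1)) * sgn x) (at x)"
    using False by (intro DERIV_chain2[where f = "\<lambda>y. y powr p"] has_real_derivative_powr) auto
  then show ?thesis by (simp add: mult.assoc)
next
  case True
  \<comment> \<open>The difference quotient at 0 has absolute value |h|^(p - 1).\<close>
  have "(\<lambda>h::real. \<bar>\<bar>h\<bar> powr p / h\<bar>) \<midarrow>0\<rightarrow> 0"
  proof (rule Lim_transform_eventually)
    show "((\<lambda>h::real. \<bar>h\<bar> powr (p - 1)) \<longlongrightarrow> 0) (at 0)"
      using assms by (intro tendsto_zero_powrI[of _ _ _ "p - 1"] tendsto_eq_intros) auto
    show "\<forall>\<^sub>F h in at (0::real). \<bar>h\<bar> powr (p - 1) = \<bar>\<bar>h\<bar> powr p / h\<bar>"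
      by (auto simp: eventually_at_filter powr_diff abs_divide)
  qed
  then have "(\<lambda>h::real. \<bar>h\<bar> powr p / h) \<midarrow>0\<rightarrow> 0"
    by (rule tendsto_rabs_zero_cancel)
  then show ?thesis using True by (simp add: DERIV_def)
qed

lemma powr_mult_self:
  fixes x :: real shows "0 \<le> x \<Longrightarrow> x powr r * x = x powr (r + 1)"
  by (cases "x = 0") (auto simp: powr_add)

text \<open>The case x = 0 is covered for every r, negative r - 2 included, by 0 powr t = 0. It
  turns the weak form evaluated at u into pure powers.\<close>

lemma powr_mult_square:
  fixes x :: real
  assumes "0 \<le> x"
  shows "x powr (r - 2) * (x * x) = x powr r"
proof -
  have "x powr (r - 2) * (x * x) = x powr (r - 2 + 1 + 1)"
    unfolding mult.assoc[symmetric] using assms by (simp only: powr_mult_self)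
  then show ?thesis by simp
qed

lemma tendsto_zero_if_young_bound:
  fixes h e :: "nat \<Rightarrow> real"
  assumes bd: "\<And>c n. 0 < c \<Longrightarrow> \<bar>h n\<bar> \<le> c * B + K c * e n" and e: "e \<longlonglongrightarrow> 0" and B: "0 \<le> B"
  shows "h \<longlonglongrightarrow> 0"
proof (rule LIMSEQ_I)
  fix r :: real assume r: "0 < r"
  \<comment> \<open>The parameter is fixed before n, so the size of \<open>K c\<close> does not
    matter; B + 1 in place of B avoids division by 0.\<close>
  define c where "c = r / (2 * (B + 1))"
  have c: "0 < c" using r B by (simp add: c_def)
  have "c * B \<le> r / 2" using r B by (simp add: c_def field_simps)
  moreover have "(\<lambda>n. K c * e n) \<longlonglongrightarrow> 0" using tendsto_mult_right_zero[OF e] by simp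
  then obtain N where N: "\<And>n. n \<ge> N \<Longrightarrow> \<bar>K c * e n\<bar> < r / 2"
    using LIMSEQ_D[of "\<lambda>n. K c * e n" 0 "r/2"] r by auto
  ultimately have "\<bar>h n\<bar> < r" if "n \<ge> N" for n
    using bd[OF c, of n] N[OF that] by linarith
  then show "\<exists>no. \<forall>n\<ge>no. norm (h n - 0) < r" by auto
qed

text \<open>A form of Hoelder's inequality in which only the pointwise Young inequality is needed.\<close>

lemma pairing_tendsto_0:
  fixes h :: "nat \<Rightarrow> 'a \<Rightarrow> real"
  assumes p: "1 < p" and w: "AE x in M. 0 \<le> w x"
    and nn: "\<And>x. 0 \<le> X x" "\<And>n x. 0 \<le> Y n x" and K: "0 \<le> K"
    and le: "\<And>n. AE x in M. \<bar>h n x\<bar> \<le> K * (w x * (X x powr (p - 1) * Y n x))"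
    and meas: "\<And>n. h n \<in> borel_measurable M"
    and X: "integrable M (\<lambda>x. w x * X x powr p)"
    and Y: "\<And>n. integrable M (\<lambda>x. w x * Y n x powr p)"
      "(\<lambda>n. \<integral>x. w x * Y n x powr p \<partial>M) \<longlonglongrightarrow> 0"
  shows "\<And>n. integrable M (h n)" "(\<lambda>n. \<integral>x. h n x \<partial>M) \<longlonglongrightarrow> 0"
proof -
  \<comment> \<open>Young's bound with parameter c: the fixed factor X gets the small coefficient,
    the vanishing factor Y the possibly large one. Any c gives integrability (c = 1 below);
    convergence uses all c.\<close>
  define D where "D c n x = c * (K * ((p - 1) / p)) * (w x * X x powr p) + K * c powr (1 - p) / p * (w x * Y n x powr p)"
    for c n x
  have D: "AE x in M. \<bar>h n x\<bar> \<le> D c n x" if "0 < c" for c n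
    using le[of n] w
  proof eventually_elim
    case (elim x)
    have "K * (w x * (X x powr (p - 1) * Y n x)) \<le>
        K * (w x * (c * ((p - 1) / p) * X x powr p + c powr (1 - p) / p * Y n x powr p))"
      using elim K nn p that by (intro mult_left_mono young_powr) auto
    also have "\<dots> = D c n x" by (simp add: D_def algebra_simps)
    finally show ?case using elim by linarith
  qed
  have Dint: "integrable M (D c n)" for c n
    unfolding D_def using X Y(1) by (intro Bochner_Integration.integrable_add integrable_mult_right) auto
  show int: "integrable M (h n)" for n
    using D[of 1 n] by (intro Bochner_Integration.integrable_bound[OF Dint[of 1 n] meas]) (auto intro: order_trans)
  show "(\<lambda>n. \<integral>x. h n x \<partial>M) \<longlonglongrightarrow> 0"
  proof (rule tendsto_zero_if_young_bound[OF _ Y(2)])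
    fix c :: real and n assume c: "0 < c"
    have "\<bar>\<integral>x. h n x \<partial>M\<bar> \<le> (\<integral>x. \<bar>h n x\<bar> \<partial>M)" by (rule integral_abs_bound)
    also have "\<dots> \<le> (\<integral>x. D c n x \<partial>M)" using D[OF c] int Dint by (intro integral_mono_AE) auto
    also have "\<dots> = c * (K * ((p - 1) / p) * (\<integral>x. w x * X x powr p \<partial>M)) +
        K * c powr (1 - p) / p * (\<integral>x. w x * Y n x powr p \<partial>M)"
      unfolding D_def using X Y(1) by (subst Bochner_Integration.integral_add) auto
    finally show "\<bar>\<integral>x. h n x \<partial>M\<bar> \<le> \<dots>" .
  next
    show "0 \<le> K * ((p - 1) / p) * (\<integral>x. w x * X x powr p \<partial>M)"
      using K p w by (intro mult_nonneg_nonneg integral_nonneg_AE) (auto elim: eventually_mono)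
  qed
qed

text \<open>The supremum of (A t^q - t^s) / t^p over t > 0, as weighted AM-GM with weights \<theta>, 1 - \<theta> gives it.\<close>

definition absorption_const :: "real \<Rightarrow> real \<Rightarrow> real \<Rightarrow> real \<Rightarrow> real" where
  "absorption_const A s q p = (let \<theta> = (q - s) / (p - s)
     in (A * (\<theta> powr \<theta> * (1 - \<theta>) powr (1 - \<theta>))) powr (1 / \<theta>))"

text \<open>As q = \<theta> p + (1 - \<theta>) s, AM-GM for \<Lambda> t^p / \<theta> and t^s / (1 -
  \<theta>) produces t^q, and \<Lambda> is chosen so that its coefficient is exactly A.\<close>

lemma absorption_le:
  fixes A t p q s :: real
  assumes exps: "0 < s" "s < q" "q < p" and A: "0 \<le> A" and t: "0 \<le> t"
  shows "A * t powr q - t powr s \<le> absorption_const A s q p * t powr p"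
proof (cases "A = 0 \<or> t = 0")
  case True then show ?thesis using exps by (auto simp: absorption_const_def)
next
  case False
  define \<theta> where "\<theta> = (q - s) / (p - s)"
  define \<Lambda> where "\<Lambda> = absorption_const A s q p"
  have \<Lambda>: "\<Lambda> = (A * (\<theta> powr \<theta> * (1 - \<theta>) powr (1 - \<theta>))) powr (1 / \<theta>)"
    by (simp add: \<Lambda>_def absorption_const_def \<theta>_def Let_def)
  have pos: "0 < A" "0 < t" using False A t by auto
  have th: "0 < \<theta>" "\<theta> < 1" using exps by (auto simp: \<theta>_def field_simps)
  have q: "p * \<theta> + s * (1 - \<theta>) = q" 
  proof -
    have "\<theta> * (p - s) = q - s" using exps by (simp add: \<theta>_def)
    then show ?thesis by (simp add: algebra_simps)
  qed
  have L: "0 < \<Lambda>" using pos th by (simp add: \<Lambda>)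
  have "(\<Lambda> * t powr p / \<theta>) powr \<theta> * (t powr s / (1 - \<theta>)) powr (1 - \<theta>)
     \<le> \<theta> * (\<Lambda> * t powr p / \<theta>) + (1 - \<theta>) * (t powr s / (1 - \<theta>))"
    using th pos L by (intro Youngs_inequality_0) auto
  also have "\<dots> = \<Lambda> * t powr p + t powr s" using th by simp
  also have "(\<Lambda> * t powr p / \<theta>) powr \<theta> = \<Lambda> powr \<theta> * t powr (p * \<theta>) / \<theta> powr \<theta>"
    using th pos L by (simp add: powr_mult powr_divide powr_powr)
  also have "(t powr s / (1 - \<theta>)) powr (1 - \<theta>) = t powr (s * (1 - \<theta>)) / (1 - \<theta>) powr (1 - \<theta>)"
    using th pos L by (simp add: powr_divide powr_powr)
  also have "\<Lambda> powr \<theta> = A * (\<theta> powr \<theta> * (1 - \<theta>) powr (1 - \<theta>))"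
    using th pos by (simp add: \<Lambda> powr_powr)
  finally have "A * (t powr (p * \<theta>) * t powr (s * (1 - \<theta>))) \<le> \<Lambda> * t powr p + t powr s"
    using th by (simp add: field_simps)
  then show ?thesis by (simp add: q flip: powr_add \<Lambda>_def)
qed

text \<open>Raising to the power q - s clears the exponent 1/\<theta>, since (q - s)/\<theta> = p -
  s. What remains is A^(p - s) k^(q - s) times T^(p - s), and the last factor is the reciprocal of
  the right side of \<open>small\<close>.\<close>

lemma absorption_const_mult_less_1:
  assumes exps: "0 < s" "s < q" "q < p" and A: "0 \<le> A" and k: "0 \<le> k"
    and small: "A powr (p - s) * k powr (q - s)
      < (p - s) powr (p - s) / ((q - s) powr (q - s) * (p - q) powr (p - q))"
  shows "absorption_const A s q p * k < 1"
proof -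
  define \<theta> where "\<theta> = (q - s) / (p - s)"
  have th: "0 < \<theta>" "0 < 1 - \<theta>" "1 - \<theta> = (p - q) / (p - s)" "\<theta> * (p - s) = q - s" "(1 - \<theta>) * (p - s) = p - q"
    using exps by (auto simp: \<theta>_def field_simps)
  define T where "T = \<theta> powr \<theta> * (1 - \<theta>) powr (1 - \<theta>)"
  have "T powr (p - s) = \<theta> powr (\<theta> * (p - s)) * (1 - \<theta>) powr ((1 - \<theta>) * (p - s))"
    by (simp add: T_def powr_mult powr_powr)
  also have "\<dots> = ((q - s) / (p - s)) powr (q - s) * ((p - q) / (p - s)) powr (p - q)"
    unfolding th(4,5) th(3) by (simp add: \<theta>_def)
  also have "\<dots> = (q - s) powr (q - s) * (p - q) powr (p - q) / ((p - s) powr (q - s) * (p - s) powr (p - q))"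
    using exps by (simp add: powr_divide)
  also have "(p - s) powr (q - s) * (p - s) powr (p - q) = (p - s) powr (p - s)"
    by (simp flip: powr_add)
  finally have T: "T powr (p - s) = (q - s) powr (q - s) * (p - q) powr (p - q) / (p - s) powr (p - s)" .
  have "1 / \<theta> * (q - s) = p - s" using exps by (simp add: \<theta>_def)
  moreover have "absorption_const A s q p = (A * T) powr (1 / \<theta>)"
    by (simp add: absorption_const_def T_def \<theta>_def Let_def)
  ultimately have "(absorption_const A s q p * k) powr (q - s) = (A * T) powr (p - s) * k powr (q - s)"
    using k by (simp add: powr_mult powr_powr)
  also have "\<dots> = T powr (p - s) * (A powr (p - s) * k powr (q - s))"
    using A by (simp add: powr_mult T_def)
  also have "\<dots> < 1"
    using small exps unfolding T by (simp add: field_simps)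
  finally show ?thesis
    using ge_one_powr_ge_zero[of "absorption_const A s q p * k" "q - s"] exps by linarith
qed

section \<open>Weights and test functions on the half-space\<close>

lemma open_halfspace: "open (halfspace :: ('m::finite) pt set)"
  unfolding halfspace_def by (intro open_Collect_less continuous_intros)

lemma halfspace_lebesgue [simp, measurable]: "halfspace \<in> sets lebesgue"
  by (intro sets_completionI_sets) (simp add: borel_open open_halfspace)

lemma space_half_leb [simp]: "space half_leb = halfspace"
  by (simp add: space_restrict_space)

lemma AE_half_lebI: "(\<And>x. x \<in> halfspace \<Longrightarrow> P x) \<Longrightarrow> AE x in half_leb. P x"
  by (rule AE_I2) simp

lemma borel_measurable_half_leb_continuous:
  "continuous_on halfspace f \<Longrightarrow> f \<in> borel_measurable half_leb"
  by (rule continuous_imp_measurable_on_sets_lebesgue) auto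

text \<open>The definition speaks only of bounded sets; on the whole half-space the weight is the
  pointwise limit of its truncations to half-balls, each of which is integrable.\<close>

lemma weight_fun_measurable:
  fixes w :: "('m::finite) pt \<Rightarrow> real"
  assumes "weight_fun w"
  shows "w \<in> borel_measurable half_leb"
proof -
  define S where "S n = (halfspace \<inter> ball 0 (real n) :: 'm pt set)" for n
  have "set_integrable lebesgue (S n) w" for n
    using assms unfolding weight_fun_def S_def
    by (elim conjE, drule_tac bspec[of _ _ "halfspace \<inter> ball 0 (real n)"]) (auto intro!: sets.Int)
  then have "(\<lambda>x. indicator (S n) x *\<^sub>R w x) \<in> borel_measurable lebesgue" for n
    unfolding set_integrable_def by (rule borel_measurable_integrable)
  then have m: "(\<lambda>x. indicator (S n) x *\<^sub>R w x) \<in> borel_measurable half_leb" for n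
    by (rule measurable_restrict_space1)
  show ?thesis
  proof (rule borel_measurable_LIMSEQ_real[OF _ m])
    fix x :: "'m pt" assume "x \<in> space half_leb"
    then have x: "x \<in> halfspace" by simp
    obtain N where "norm x < real N" using reals_Archimedean2 by blast
    then have "\<forall>n\<ge>N. indicator (S n) x *\<^sub>R w x = w x"
      using x by (auto simp: S_def indicator_def)
    then show "(\<lambda>n. indicator (S n) x *\<^sub>R w x) \<longlonglongrightarrow> w x"
      by (intro tendsto_eventually) (auto simp: eventually_sequentially simp del: real_scaleR_def)
  qed
qed

lemma weight_fun_nonneg: "weight_fun w \<Longrightarrow> AE x in half_leb. 0 \<le> w x"
  by (auto simp: weight_fun_def elim: eventually_mono)

lemma weight_fun_integrable_mult:
  fixes w g :: "('m::finite) pt \<Rightarrow> real"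
  assumes w: "weight_fun w" and g: "g \<in> borel_measurable half_leb"
    and bd: "\<And>x. x \<in> halfspace \<Longrightarrow> \<bar>g x\<bar> \<le> K"
    and S: "bounded S" "\<And>x. x \<in> halfspace \<Longrightarrow> x \<notin> S \<Longrightarrow> g x = 0"
  shows "integrable half_leb (\<lambda>x. w x * g x)"
proof -
  \<comment> \<open>\<open>S\<close> is arbitrary and perhaps not measurable; the part of an
    enclosing box in the half-space is.\<close>
  obtain a where a: "S \<subseteq> cbox (-a) a" using bounded_subset_cbox_symmetric[OF S(1)] by blast
  define T where "T = halfspace \<inter> cbox (-a) a"
  have T: "T \<in> sets lebesgue" "bounded T" "T \<subseteq> halfspace" by (auto simp: T_def)
  then have "set_integrable lebesgue T w" using w by (auto simp: weight_fun_def)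
  moreover have "(\<lambda>x. indicator halfspace x *\<^sub>R indicator T x *\<^sub>R w x) = (\<lambda>x. indicator T x *\<^sub>R w x)"
    using T by (auto simp: indicator_def fun_eq_iff)
  ultimately have "integrable half_leb (\<lambda>x. indicator T x *\<^sub>R w x)"
    by (simp only: set_integrable_def) (subst integrable_restrict_space, auto)
  then have "integrable half_leb (\<lambda>x. K * (indicator T x *\<^sub>R w x))" by simp
  then show ?thesis
  proof (rule Bochner_Integration.integrable_bound)
    show "(\<lambda>x. w x * g x) \<in> borel_measurable half_leb"
      using weight_fun_measurable[OF w] g by measurable
    show "AE x in half_leb. norm (w x * g x) \<le> norm (K * (indicator T x *\<^sub>R w x))"
    proof (rule AE_half_lebI)
      fix x :: "'m pt" assume x: "x \<in> halfspace"
      show "norm (w x * g x) \<le> norm (K * (indicator T x *\<^sub>R w x))"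
        using bd[OF x] S(2)[OF x] a x mult_left_mono[of "\<bar>g x\<bar>" "\<bar>K\<bar>" "\<bar>w x\<bar>"]
        by (cases "x \<in> S") (auto simp: T_def abs_mult algebra_simps)
    qed
  qed
qed

lemma weight_fun_powr: "weight_fun (\<lambda>x :: ('m::finite) pt. (1 + snd x) powr r)"
  unfolding weight_fun_def
proof (intro conjI ballI impI)
  show "AE x :: 'm pt in half_leb. 0 < (1 + snd x) powr r"
    by (rule AE_half_lebI) (simp add: halfspace_def)
next
  fix S :: "'m pt set" assume S: "S \<in> sets lebesgue" "bounded S \<and> S \<subseteq> halfspace"
  obtain y r' where a: "S \<subseteq> cbox (- (y, r')) (y, r')"
    using bounded_subset_cbox_symmetric S by (metis surj_pair)
  \<comment> \<open>With the lower face moved up to x_N = 0, the base 1 + x_N is at least 1 on the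
    closed box, so the weight is continuous there for every r.\<close>
  define B where "B = cbox (- y, 0) (y, r')"
  have "S \<subseteq> B"
  proof
    fix x assume "x \<in> S"
    then have "x \<in> cbox (- (y, r')) (y, r')" "0 < snd x" using a S by (auto simp: halfspace_def)
    then show "x \<in> B" by (cases x) (auto simp: B_def cbox_Pair_eq)
  qed
  moreover have "continuous_on B (\<lambda>x. (1 + snd x) powr r)"
    by (intro continuous_intros) (auto simp: B_def cbox_Pair_eq)
  then have "set_integrable lebesgue B (\<lambda>x. (1 + snd x) powr r)"
    unfolding B_def by (rule absolutely_integrable_continuous)
  ultimately show "set_integrable lebesgue S (\<lambda>x :: 'm pt. (1 + snd x) powr r)"
    using S set_integrable_subset by blast
qed

section \<open>Smooth test functions, their gradients and their supports\<close>

lemma smooth_differentiable: "smooth f \<Longrightarrow> f differentiable (at x)"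
  unfolding smooth_def by (drule spec[of _ "Suc 0"]) simp

lemma smooth_continuous: "smooth f \<Longrightarrow> continuous_on S f"
  unfolding smooth_def by (drule spec[of _ 0]) (auto intro: continuous_on_subset)

lemma smooth_continuous_grad: "smooth f \<Longrightarrow> continuous_on S (grad f)"
  unfolding smooth_def grad_def
  by (drule spec[of _ "Suc 0"]) (auto intro!: continuous_intros intro: continuous_on_subset)

lemma grad_inner_Basis: "i \<in> Basis \<Longrightarrow> grad f x \<bullet> i = frechet_derivative f (at x) i"
  by (simp add: grad_def inner_sum_left_Basis)

lemma grad_cong_open:
  assumes "f differentiable (at x)" "open X" "x \<in> X" "\<And>y. y \<in> X \<Longrightarrow> f y = g y"
  shows "grad f x = grad g x"
  unfolding grad_def by (subst frechet_derivative_transform_within_open[OF assms]) simp_all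

lemma grad_zero [simp]: "grad (\<lambda>_. 0) = (\<lambda>_. 0)"
  by (simp add: grad_def fun_eq_iff)

text \<open>The support is enclosed in a box so that Fubini can later be applied; the gradient
  vanishes outside because \<psi> is 0 on the open complement.\<close>

lemma Cc_infty_support:
  fixes \<psi> :: "'a::euclidean_space \<Rightarrow> real"
  assumes "\<psi> \<in> Cc_infty \<Omega>"
  obtains a where "\<And>x. x \<notin> cbox (-a) a \<Longrightarrow> \<psi> x = 0" "\<And>x. x \<notin> cbox (-a) a \<Longrightarrow> grad \<psi> x = 0"
proof -
  let ?S = "closure {x. \<psi> x \<noteq> 0}"
  obtain a where a: "?S \<subseteq> cbox (-a) a"
    using bounded_subset_cbox_symmetric[of ?S] assms compact_imp_bounded by (auto simp: Cc_infty_def)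
  have out: "\<psi> x = 0" if "x \<notin> cbox (-a) a" for x
    using that a closure_subset[of "{x. \<psi> x \<noteq> 0}"] by blast
  have "grad \<psi> x = grad (\<lambda>_. 0) x" if "x \<notin> cbox (-a) a" for x
    using that out assms
    by (intro grad_cong_open[of _ _ "- cbox (-a) a"] smooth_differentiable)
      (auto simp: Cc_infty_def open_Compl)
  then have "grad \<psi> x = 0" if "x \<notin> cbox (-a) a" for x using that by simp
  with out show thesis by (rule that)
qed

text \<open>Values of \<phi> off the half-space are arbitrary, so work is moved to the globally
  smooth \<psi>; gradients agree because the half-space is open.\<close>

lemma C_deltaE:
  assumes "\<phi> \<in> C_delta"
  obtains \<psi> where "\<psi> \<in> Cc_infty UNIV" "\<And>x. x \<in> halfspace \<Longrightarrow> \<phi> x = \<psi> x"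
    "\<And>x. x \<in> halfspace \<Longrightarrow> grad \<phi> x = grad \<psi> x"
proof -
  obtain \<psi> where \<psi>: "\<psi> \<in> Cc_infty UNIV" "\<forall>x\<in>halfspace. \<phi> x = \<psi> x"
    using assms by (auto simp: C_delta_def)
  have "grad \<psi> x = grad \<phi> x" if "x \<in> halfspace" for x
    using \<psi> that by (intro grad_cong_open[OF _ open_halfspace] smooth_differentiable) (auto simp: Cc_infty_def)
  with \<psi> that show thesis by simp
qed

lemma wLp_continuous:
  fixes w :: "('m::finite) pt \<Rightarrow> real" and g :: "'m pt \<Rightarrow> 'b::euclidean_space"
  assumes w: "weight_fun w" and p: "0 < p" and g: "continuous_on UNIV g"
    and supp: "\<And>x. x \<notin> cbox (-a) a \<Longrightarrow> g x = 0"
  shows "g \<in> wLp p w"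
proof -
  have meas: "g \<in> borel_measurable half_leb"
    using g by (intro borel_measurable_half_leb_continuous) (rule continuous_on_subset, auto)
  have "compact (g ` cbox (-a) a)"
    using g by (intro compact_continuous_image compact_cbox) (rule continuous_on_subset, auto)
  then obtain K where K: "\<And>x. x \<in> cbox (-a) a \<Longrightarrow> norm (g x) \<le> K"
    using compact_imp_bounded bounded_iff by (metis imageI)
  have "norm (g x) powr p \<le> \<bar>K\<bar> powr p" for x
    using K[of x] supp[of x] p by (cases "x \<in> cbox (-a) a") (auto intro!: powr_mono2)
  then have "integrable half_leb (\<lambda>x. w x * norm (g x) powr p)"
    using meas p supp by (intro weight_fun_integrable_mult[OF w, where S = "cbox (-a) a" and K = "\<bar>K\<bar> powr p"]) auto
  with meas show ?thesis by (simp add: wLp_def)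
qed

lemma wLp_cong:
  assumes "\<And>x. x \<in> halfspace \<Longrightarrow> f x = g x"
  shows "f \<in> wLp p w \<longleftrightarrow> g \<in> wLp p w"
proof -
  have "f \<in> borel_measurable half_leb \<longleftrightarrow> g \<in> borel_measurable half_leb"
    using assms by (intro measurable_cong) auto
  moreover have "integrable half_leb (\<lambda>x. w x * norm (f x) powr p) \<longleftrightarrow> integrable half_leb (\<lambda>x. w x * norm (g x) powr p)"
    using assms by (intro Bochner_Integration.integrable_cong) auto
  ultimately show ?thesis by (simp add: wLp_def)
qed

lemma C_delta_wLp:
  assumes w: "weight_fun w" and p: "0 < p" and \<phi>: "\<phi> \<in> C_delta"
  shows "\<phi> \<in> wLp p w" "grad \<phi> \<in> wLp p w"
proof -
  obtain \<psi> where \<psi>: "\<psi> \<in> Cc_infty UNIV" "\<And>x. x \<in> halfspace \<Longrightarrow> \<phi> x = \<psi> x"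
    "\<And>x. x \<in> halfspace \<Longrightarrow> grad \<phi> x = grad \<psi> x" using C_deltaE[OF \<phi>] by blast
  obtain a where a: "\<And>x. x \<notin> cbox (-a) a \<Longrightarrow> \<psi> x = 0" "\<And>x. x \<notin> cbox (-a) a \<Longrightarrow> grad \<psi> x = 0"
    using Cc_infty_support[OF \<psi>(1)] by blast
  have sm: "smooth \<psi>" using \<psi> by (simp add: Cc_infty_def)
  have "\<psi> \<in> wLp p w" using wLp_continuous[OF w p smooth_continuous[OF sm] a(1)] by blast
  then show "\<phi> \<in> wLp p w" using wLp_cong[of \<phi> \<psi>] \<psi>(2) by blast
  have "grad \<psi> \<in> wLp p w" using wLp_continuous[OF w p smooth_continuous_grad[OF sm] a(2)] by blast
  then show "grad \<phi> \<in> wLp p w" using wLp_cong[of "grad \<phi>" "grad \<psi>"] \<psi>(3) by blast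
qed

section \<open>The weighted Hardy inequality\<close>

text \<open>Young's inequality shows that the integrand is at most the derivative of
  (1 + t)^(\<gamma> - p + 1) |f t|^p, a function that vanishes at R and is nonnegative at 0.\<close>

lemma hardy_interval:
  fixes f f' :: "real \<Rightarrow> real"
  assumes p: "1 < p" "p - 1 < \<gamma>" and R: "0 \<le> R" "f R = 0"
    and der: "\<And>t. (f has_real_derivative f' t) (at t)" and cont: "continuous_on {0..R} f'"
  defines "C \<equiv> (\<gamma> - p + 1) / p"
  shows "integral {0..R} (\<lambda>t. C * ((1 + t) powr (\<gamma> - p) * \<bar>f t\<bar> powr p)
      - C powr (1 - p) * ((1 + t) powr \<gamma> * \<bar>f' t\<bar> powr p)) \<le> 0" (is "integral _ ?g \<le> 0")
proof -
  define c where "c = \<gamma> - p + 1"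
  have c: "c = p * C" and C: "0 < C" using p by (auto simp: c_def C_def)
  define F where "F t = (1 + t) powr c * \<bar>f t\<bar> powr p" for t
  define F' where "F' t = (1 + t) powr c * (p * \<bar>f t\<bar> powr (p - 1) * sgn (f t) * f' t)
      + c * (1 + t) powr (c - 1) * \<bar>f t\<bar> powr p" for t
  have F: "(F has_vector_derivative F' t) (at t within {0..R})" if "t \<in> {0..R}" for t
  proof -
    have "((\<lambda>x. (1 + x) powr c) has_real_derivative c * (1 + t) powr (c - 1) * (0 + 1)) (at t)"
      using that by (intro DERIV_chain2[where f = "\<lambda>y. y powr c"] has_real_derivative_powr
          DERIV_add DERIV_const DERIV_ident) auto
    moreover have "((\<lambda>x. \<bar>f x\<bar> powr p) has_real_derivative
        p * \<bar>f t\<bar> powr (p - 1) * sgn (f t) * f' t) (at t)"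
      by (rule DERIV_chain2[OF has_real_derivative_abs_powr[OF p(1)] der])
    ultimately have "(F has_real_derivative c * (1 + t) powr (c - 1) * (0 + 1) * \<bar>f t\<bar> powr p +
        p * \<bar>f t\<bar> powr (p - 1) * sgn (f t) * f' t * (1 + t) powr c) (at t)"
      unfolding F_def by (rule DERIV_mult)
    then have "(F has_real_derivative F' t) (at t)" by (simp add: F'_def algebra_simps)
    then show ?thesis
      by (simp add: has_real_derivative_iff_has_vector_derivative has_vector_derivative_at_within)
  qed
  have le: "?g t \<le> F' t" if "t \<in> {0..R}" for t
  proof -
    have t: "0 < 1 + t" using that by simp
    define w where "w = (1 + t) powr (\<gamma> - p)"
    have w: "w * (1 + t) = (1 + t) powr c" "w * (1 + t) powr p = (1 + t) powr \<gamma>" 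
      using t by (simp_all add: w_def c_def powr_add powr_diff)
    have w0: "0 \<le> w" and w1: "(1 + t) powr (c - 1) = w" by (simp_all add: w_def c_def)
    \<comment> \<open>The factor 1 + t is attached to f' so that, after multiplication by
      \<open>w\<close>, the two terms carry the weights (1 + t)^(\<gamma> - p) and (1 + t)^\<gamma>.
      The choice c = C of the Young parameter gives the stated constant.\<close>
    have "\<bar>f t\<bar> powr (p - 1) * ((1 + t) * \<bar>f' t\<bar>) \<le> C * ((p - 1) / p) * \<bar>f t\<bar> powr p
        + C powr (1 - p) / p * ((1 + t) * \<bar>f' t\<bar>) powr p"
      using p C t by (intro young_powr) auto
    then have young: "\<bar>f t\<bar> powr (p - 1) * ((1 + t) * \<bar>f' t\<bar>) \<le> C * ((p - 1) / p) * \<bar>f t\<bar> powr p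
        + C powr (1 - p) / p * ((1 + t) powr p * \<bar>f' t\<bar> powr p)"
      using t by (simp only: powr_mult)
    have "p * ((w * (1 + t)) * (\<bar>f t\<bar> powr (p - 1) * \<bar>f' t\<bar>))
        = (w * p) * (\<bar>f t\<bar> powr (p - 1) * ((1 + t) * \<bar>f' t\<bar>))"
      by (simp only: mult_ac)
    also have "\<dots> \<le> (w * p) * (C * ((p - 1) / p) * \<bar>f t\<bar> powr p
        + C powr (1 - p) / p * ((1 + t) powr p * \<bar>f' t\<bar> powr p))"
      using p w0 young by (intro mult_left_mono) auto
    also have "\<dots> = C * (p - 1) * (w * \<bar>f t\<bar> powr p)
        + C powr (1 - p) * ((w * (1 + t) powr p) * \<bar>f' t\<bar> powr p)"
    proof -
      have "w * p * (C * ((p - 1) / p) * P + K / p * (X * d)) = C * (p - 1) * (w * P) + K * ((w * X) * d)"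
        for P K X d using p by (simp add: field_simps)
      then show ?thesis .
    qed
    finally have "p * ((w * (1 + t)) * (\<bar>f t\<bar> powr (p - 1) * \<bar>f' t\<bar>)) \<le> C * (p - 1) * (w * \<bar>f t\<bar> powr p)
        + C powr (1 - p) * ((w * (1 + t) powr p) * \<bar>f' t\<bar> powr p)" .
    moreover have "- (\<bar>f t\<bar> powr (p - 1) * \<bar>f' t\<bar>) \<le> \<bar>f t\<bar> powr (p - 1) * sgn (f t) * f' t"
      using p by (cases "f t = 0"; cases "f' t \<ge> 0"; cases "f t > 0") (auto simp: mult_nonneg_nonneg mult_nonneg_nonpos)
    from mult_left_mono[OF this, of "p * (1 + t) powr c"]
    have "- (p * ((1 + t) powr c * (\<bar>f t\<bar> powr (p - 1) * \<bar>f' t\<bar>)))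
       \<le> (1 + t) powr c * (p * \<bar>f t\<bar> powr (p - 1) * sgn (f t) * f' t)"
      using p by (simp add: algebra_simps)
    \<comment> \<open>Since c = p C, the |f|^p terms combine to p C - C (p - 1) = C.\<close>
    ultimately show ?thesis
      unfolding F'_def w w1 by (simp add: c algebra_simps flip: w_def)
  qed
  have "continuous_on {0..R} f"
    using der by (meson DERIV_isCont continuous_at_imp_continuous_on)
  moreover have "continuous_on {0..R} (\<lambda>t. \<bar>h t\<bar> powr p)" if "continuous_on {0..R} h" for h :: "real \<Rightarrow> real"
    using that p by (intro continuous_on_powr' continuous_on_rabs continuous_on_const) auto
  moreover have "continuous_on {0..R} (\<lambda>t. (1 + t) powr r)" for r
    by (intro continuous_on_powr continuous_on_add continuous_on_const continuous_on_id) auto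
  ultimately have "?g integrable_on {0..R}"
    using cont by (intro integrable_continuous_real continuous_on_diff continuous_on_mult continuous_on_const) auto
  moreover have "(F' has_integral (F R - F 0)) {0..R}"
    using R F by (intro fundamental_theorem_of_calculus) auto
  ultimately have "integral {0..R} ?g \<le> F R - F 0"
    using le by (intro has_integral_le[OF integrable_integral]) auto
  also have "\<dots> \<le> 0" using R by (simp add: F_def)
  finally show ?thesis .
qed

text \<open>The interval version is applied on each line in direction x_N and integrated over x';
  only the last partial derivative enters, which is bounded by the full gradient at the end.\<close>

lemma hardy_C_delta:
  fixes \<phi> :: "('m::finite) pt \<Rightarrow> real"
  assumes p: "1 < p" "p - 1 < \<gamma>" and \<phi>: "\<phi> \<in> C_delta"
  shows "(\<integral>x. (1 + snd x) powr (\<gamma> - p) * norm (\<phi> x) powr p \<partial>half_leb)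
    \<le> ((\<gamma> - p + 1) / p) powr (- p) * (\<integral>x. (1 + snd x) powr \<gamma> * norm (grad \<phi> x) powr p \<partial>half_leb)"
proof -
  obtain \<psi> where \<psi>: "\<psi> \<in> Cc_infty UNIV" "\<And>x. x \<in> halfspace \<Longrightarrow> \<phi> x = \<psi> x"
    "\<And>x. x \<in> halfspace \<Longrightarrow> grad \<phi> x = grad \<psi> x" using C_deltaE[OF \<phi>] by blast
  obtain z r where a: "\<And>x. x \<notin> cbox (- (z, r)) (z, r) \<Longrightarrow> \<psi> x = 0"
      "\<And>x. x \<notin> cbox (- (z, r)) (z, r) \<Longrightarrow> grad \<psi> x = 0"
    using Cc_infty_support[OF \<psi>(1)] by (metis surj_pair)
  have sm: "smooth \<psi>" using \<psi> by (simp add: Cc_infty_def)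
  define e :: "'m pt" where "e = (0, 1)"
  have e: "e \<in> Basis" by (simp add: e_def Basis_prod_def)
  define D where "D x = grad \<psi> x \<bullet> e" for x
  have contD: "continuous_on S D" for S
    unfolding D_def by (intro continuous_intros smooth_continuous_grad sm)
  have derD: "((\<lambda>t. \<psi> (y, t)) has_real_derivative D (y, t)) (at t)" for y t
  proof -
    have "(\<psi> has_derivative frechet_derivative \<psi> (at (y, t))) (at (y, t))"
      using smooth_differentiable[OF sm] frechet_derivative_works by blast
    then have "((\<lambda>t. \<psi> (y, t)) has_derivative (\<lambda>h. frechet_derivative \<psi> (at (y, t)) (0, h))) (at t)"
      by (rule has_derivative_compose[rotated]) (auto intro!: derivative_eq_intros)
    moreover have "frechet_derivative \<psi> (at (y, t)) (0, h) = D (y, t) * h" for h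
      using linear_cmul[OF linear_frechet_derivative[OF smooth_differentiable[OF sm]], of "(y, t)" h e]
      using grad_inner_Basis[OF e, of \<psi> "(y, t)"] by (simp add: D_def e_def)
    ultimately show ?thesis by (simp add: has_field_derivative_def)
  qed
  define C where "C = (\<gamma> - p + 1) / p"
  have C: "0 < C" using p by (simp add: C_def)
  define U where "U x = (1 + snd x) powr (\<gamma> - p) * norm (\<psi> x) powr p" for x
  define V where "V x = (1 + snd x) powr \<gamma> * norm (D x) powr p" for x
  have "\<psi> \<in> wLp p (\<lambda>x. (1 + snd x) powr (\<gamma> - p))"
    using p a(1) by (intro wLp_continuous[where a = "(z, r)", OF weight_fun_powr _ smooth_continuous[OF sm]]) simp_all
  then have U: "integrable half_leb U" by (simp add: U_def[abs_def] wLp_def)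
  have "D \<in> wLp p (\<lambda>x. (1 + snd x) powr \<gamma>)"
    using p a(2) by (intro wLp_continuous[where a = "(z, r)", OF weight_fun_powr _ contD]) (simp_all add: D_def)
  then have V: "integrable half_leb V" by (simp add: V_def[abs_def] wLp_def)
  \<comment> \<open>Keeping both sides in one integrand, continuous on a closed box, allows a single
    use of Fubini for continuous functions.\<close>
  define g where "g x = C * U x - C powr (1 - p) * V x" for x
  \<comment> \<open>Strictly above the support box, so \<psi> vanishes at height R, and nonnegative
    even if r < 0.\<close>
  define R where "R = \<bar>r\<bar> + 1"
  define B where "B = cbox (- z, 0) (z, R)"
  have R: "0 \<le> R" "\<psi> (y, R) = 0" for y
  proof -
    have "(y, R) \<notin> cbox (- (z, r)) (z, r)" by (auto simp: R_def cbox_Pair_eq)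
    then show "\<psi> (y, R) = 0" by (rule a(1))
  qed (simp add: R_def)
  have pw: "continuous_on B (\<lambda>x. norm (h x) powr p)" if "continuous_on B h" for h :: "'m pt \<Rightarrow> real"
    using that p by (intro continuous_on_powr' continuous_on_norm continuous_on_const) auto
  have "continuous_on B (\<lambda>x. (1 + snd x) powr t)" for t
    by (intro continuous_on_powr continuous_on_add continuous_on_const continuous_on_snd continuous_on_id)
      (auto simp: B_def cbox_Pair_eq)
  then have gB: "continuous_on B g"
    unfolding g_def U_def V_def
    by (intro continuous_on_diff continuous_on_mult continuous_on_const pw contD smooth_continuous[OF sm]) auto
  have "(\<integral>x. g x \<partial>half_leb) = integral halfspace g"
    unfolding g_def using U V by (intro lebesgue_integral_eq_integral) auto
  also have "\<dots> = integral B g"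
  \<comment> \<open>Inside the half-space g vanishes off B; B leaves the half-space only in the null
    hyperplane x_N = 0.\<close>
  proof (rule integral_spike_set)
    have "g x = 0" if "x \<in> halfspace - B" for x
    proof -
      have "x \<notin> cbox (- (z, r)) (z, r)"
        using that by (cases x) (auto simp: halfspace_def B_def R_def cbox_Pair_eq)
      then show ?thesis using p a[of x] by (simp add: g_def U_def V_def D_def)
    qed
    then have E: "{x \<in> halfspace - B. g x \<noteq> 0} = {}" by blast
    show "negligible {x \<in> halfspace - B. g x \<noteq> 0}" unfolding E by simp
    have "{x \<in> B - halfspace. g x \<noteq> 0} \<subseteq> {x. x \<bullet> e = 0}"
      by (auto simp: B_def halfspace_def e_def cbox_Pair_eq)
    then show "negligible {x \<in> B - halfspace. g x \<noteq> 0}"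
      using negligible_standard_hyperplane[OF e, of 0] negligible_subset by blast
  qed
  also have "\<dots> = integral (cbox (- z) (z)) (\<lambda>y. integral (cbox 0 R) (\<lambda>t. g (y, t)))"
    using gB unfolding B_def by (rule integral_prod_continuous)
  also have "\<dots> \<le> 0"
  proof -
    have "integral (cbox 0 R) (\<lambda>t. g (y, t)) \<le> 0" for y
    proof -
      have "continuous_on {0..R} (\<lambda>t. D (y, t))"
        by (rule continuous_on_compose2[OF contD[of UNIV]]) (auto intro!: continuous_intros)
      from hardy_interval[OF p R derD this]
      show ?thesis by (simp add: g_def U_def V_def C_def)
    qed
    \<comment> \<open>If the inner integral were not integrable in y, the outer one would take the
      default value 0, so the sign holds in either case.\<close>
    then show ?thesis
      using integral_le[of "\<lambda>y. integral (cbox 0 R) (\<lambda>t. g (y, t))" "cbox (- z) (z)" "\<lambda>_. 0"]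
      by (cases "(\<lambda>y. integral (cbox 0 R) (\<lambda>t. g (y, t))) integrable_on cbox (- z) (z)")
        (auto simp: not_integrable_integral)
  qed
  finally have "C * (\<integral>x. U x \<partial>half_leb) \<le> C powr (1 - p) * (\<integral>x. V x \<partial>half_leb)"
    unfolding g_def using U V by simp
  then have "(\<integral>x. U x \<partial>half_leb) \<le> C powr (- p) * (\<integral>x. V x \<partial>half_leb)"
    using C by (simp add: powr_diff powr_minus field_simps)
  also have "(\<integral>x. V x \<partial>half_leb) \<le> (\<integral>x. (1 + snd x) powr \<gamma> * norm (grad \<phi> x) powr p \<partial>half_leb)"
  proof (rule integral_mono_AE[OF V])
    show "integrable half_leb (\<lambda>x. (1 + snd x) powr \<gamma> * norm (grad \<phi> x) powr p)"
      using C_delta_wLp(2)[OF weight_fun_powr _ \<phi>, of p \<gamma>] p by (simp add: wLp_def)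
    show "AE x in half_leb. V x \<le> (1 + snd x) powr \<gamma> * norm (grad \<phi> x) powr p"
    proof (rule AE_half_lebI)
      fix x :: "'m pt" assume "x \<in> halfspace"
      then have "\<bar>D x\<bar> \<le> norm (grad \<phi> x)" using Basis_le_norm[OF e] \<psi>(3) by (simp add: D_def)
      then show "V x \<le> (1 + snd x) powr \<gamma> * norm (grad \<phi> x) powr p"
        using p by (auto simp: V_def intro!: mult_left_mono powr_mono2)
    qed
  qed
  also have "(\<integral>x. U x \<partial>half_leb) = (\<integral>x. (1 + snd x) powr (\<gamma> - p) * norm (\<phi> x) powr p \<partial>half_leb)"
    using \<psi>(2) by (intro Bochner_Integration.integral_cong) (auto simp: U_def)
  finally show ?thesis by (simp add: C_def mult_left_mono)
qed

section \<open>Weighted L^p estimates and the Hardy inequality on the completion\<close>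

lemma wLp_diff:
  assumes w: "weight_fun w" and p: "1 < p" and f: "f \<in> wLp p w" and g: "g \<in> wLp p w"
  shows "(\<lambda>x. f x - g x) \<in> wLp p w"
proof -
  have [measurable]: "w \<in> borel_measurable half_leb" "f \<in> borel_measurable half_leb" "g \<in> borel_measurable half_leb"
    using weight_fun_measurable[OF w] f g by (auto simp: wLp_def)
  define c where "c = (1 / 2 :: real) powr (1 - p)"
  have "integrable half_leb (\<lambda>x. c * (w x * norm (f x) powr p) + c * (w x * norm (g x) powr p))"
    using f g by (auto simp: wLp_def)
  then have "integrable half_leb (\<lambda>x. w x * norm (f x - g x) powr p)"
  proof (rule Bochner_Integration.integrable_bound)
    show "AE x in half_leb. norm (w x * norm (f x - g x) powr p)
        \<le> norm (c * (w x * norm (f x) powr p) + c * (w x * norm (g x) powr p))"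
      using weight_fun_nonneg[OF w]
    proof eventually_elim
      case (elim x)
      have "norm (f x - g x) powr p \<le> c * norm (f x) powr p + c * norm (g x) powr p"
        using norm_powr_le[of "1 / 2" p "f x - g x" "f x"] p by (simp add: c_def)
      from mult_left_mono[OF this elim] elim show ?case
        by (simp add: algebra_simps abs_mult)
    qed
  qed measurable
  then show ?thesis by (simp add: wLp_def)
qed

text \<open>Stands in for Minkowski's inequality: replacing f by a nearby g costs a factor as close
  to 1 as desired, plus a multiple of the error.\<close>

lemma integral_wLp_le:
  assumes w: "weight_fun w" and p: "1 < p" and f: "f \<in> wLp p w" and g: "g \<in> wLp p w"
    and l: "0 < l" "l < 1"
  shows "(\<integral>x. w x * norm (f x) powr p \<partial>half_leb) \<le> (1 - l) powr (1 - p) * (\<integral>x. w x * norm (g x) powr p \<partial>half_leb)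
    + l powr (1 - p) * (\<integral>x. w x * norm (f x - g x) powr p \<partial>half_leb)"
proof -
  note int = f[unfolded wLp_def] g[unfolded wLp_def] wLp_diff[OF w p f g, unfolded wLp_def]
  have "(\<integral>x. w x * norm (f x) powr p \<partial>half_leb) \<le> (\<integral>x. (1 - l) powr (1 - p) * (w x * norm (g x) powr p)
      + l powr (1 - p) * (w x * norm (f x - g x) powr p) \<partial>half_leb)"
  proof (rule integral_mono_AE)
    show "AE x in half_leb. w x * norm (f x) powr p \<le> (1 - l) powr (1 - p) * (w x * norm (g x) powr p)
      + l powr (1 - p) * (w x * norm (f x - g x) powr p)"
      using weight_fun_nonneg[OF w]
    proof eventually_elim
      case (elim x)
      from mult_left_mono[OF norm_powr_le[OF l p, of "f x" "g x"] elim] show ?case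
        by (simp add: algebra_simps)
    qed
  qed (use int in auto)
  also have "\<dots> = (1 - l) powr (1 - p) * (\<integral>x. w x * norm (g x) powr p \<partial>half_leb)
    + l powr (1 - p) * (\<integral>x. w x * norm (f x - g x) powr p \<partial>half_leb)"
    using int by simp
  finally show ?thesis .
qed

lemma wnorm_tendsto_0D:
  assumes w: "weight_fun w" and p: "0 < p" and lim: "(\<lambda>n. wnorm p w (f n)) \<longlonglongrightarrow> 0"
  shows "(\<lambda>n. \<integral>x. w x * norm (f n x) powr p \<partial>half_leb) \<longlonglongrightarrow> 0"
proof -
  have nn: "0 \<le> (\<integral>x. w x * norm (f n x) powr p \<partial>half_leb)" for n
    using weight_fun_nonneg[OF w] by (intro integral_nonneg_AE) (auto elim: eventually_mono)
  have "(\<lambda>n. wnorm p w (f n) powr p) \<longlonglongrightarrow> 0"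
    using lim p by (intro tendsto_zero_powrI[of _ _ _ p] always_eventually) (auto simp: wnorm_def)
  moreover have "wnorm p w (f n) powr p = (\<integral>x. w x * norm (f n x) powr p \<partial>half_leb)" for n
    using nn p by (simp add: wnorm_def powr_powr)
  ultimately show ?thesis by simp
qed

lemma hardy_space_E:
  fixes \<rho> u :: "('m::finite) pt \<Rightarrow> real"
  assumes p: "1 < p" "p - 1 < \<gamma>" and \<rho>: "weight_fun \<rho>" and \<rho>0: "0 < \<rho>\<^sub>0"
    and lower: "AE x in half_leb. \<rho>\<^sub>0 * (1 + snd x) powr \<gamma> \<le> \<rho> x"
    and E: "(u, G) \<in> space_E \<rho> p \<gamma>"
  shows "(\<integral>x. (1 + snd x) powr (\<gamma> - p) * norm (u x) powr p \<partial>half_leb)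
    \<le> ((\<gamma> - p + 1) / p) powr (- p) / \<rho>\<^sub>0 * (\<integral>x. \<rho> x * norm (G x) powr p \<partial>half_leb)" (is "?U \<le> ?K * ?R")
proof -
  let ?w = "\<lambda>x :: 'm pt. (1 + snd x) powr (\<gamma> - p)"
  obtain \<phi> where \<phi>: "\<And>n. \<phi> n \<in> C_delta"
    and limG: "(\<lambda>n. wnorm p \<rho> (\<lambda>x. grad (\<phi> n) x - G x)) \<longlonglongrightarrow> 0"
    and limu: "(\<lambda>n. wnorm p ?w (\<lambda>x. \<phi> n x - u x)) \<longlonglongrightarrow> 0"
    using E by (auto simp: space_E_def)
  have u: "u \<in> wLp p ?w" and G: "G \<in> wLp p \<rho>" using E by (auto simp: space_E_def)
  define e where "e n = (\<integral>x. ?w x * norm (\<phi> n x - u x) powr p \<partial>half_leb)" for n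
  define d where "d n = (\<integral>x. \<rho> x * norm (grad (\<phi> n) x - G x) powr p \<partial>half_leb)" for n
  have e: "e \<longlonglongrightarrow> 0" unfolding e_def
    using wnorm_tendsto_0D[OF weight_fun_powr _ limu] p by simp
  have d: "d \<longlonglongrightarrow> 0" unfolding d_def
    using wnorm_tendsto_0D[OF \<rho> _ limG] p by simp
  have K: "0 \<le> ?K" using \<rho>0 by simp
  have hardy: "(\<integral>x. ?w x * norm (\<phi> n x) powr p \<partial>half_leb) \<le> ?K * (\<integral>x. \<rho> x * norm (grad (\<phi> n) x) powr p \<partial>half_leb)" for n
  proof -
    have int: "integrable half_leb (\<lambda>x. (1 + snd x) powr \<gamma> * norm (grad (\<phi> n) x) powr p)"
        "integrable half_leb (\<lambda>x. \<rho> x * norm (grad (\<phi> n) x) powr p)"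
      using C_delta_wLp(2)[OF weight_fun_powr _ \<phi>[of n], of p \<gamma>] C_delta_wLp(2)[OF \<rho> _ \<phi>[of n], of p] p
      by (auto simp: wLp_def)
    have "(\<integral>x. ?w x * norm (\<phi> n x) powr p \<partial>half_leb)
        \<le> ((\<gamma> - p + 1) / p) powr (- p) * (\<integral>x. (1 + snd x) powr \<gamma> * norm (grad (\<phi> n) x) powr p \<partial>half_leb)"
      by (rule hardy_C_delta[OF p \<phi>])
    also have "(\<integral>x. (1 + snd x) powr \<gamma> * norm (grad (\<phi> n) x) powr p \<partial>half_leb)
        \<le> (\<integral>x. (\<rho> x * norm (grad (\<phi> n) x) powr p) / \<rho>\<^sub>0 \<partial>half_leb)"
    proof (rule integral_mono_AE[OF int(1)])
      show "AE x in half_leb. (1 + snd x) powr \<gamma> * norm (grad (\<phi> n) x) powr p \<le> \<rho> x * norm (grad (\<phi> n) x) powr p / \<rho>\<^sub>0"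
        using lower
      proof eventually_elim
        case (elim x)
        from mult_right_mono[OF elim, of "norm (grad (\<phi> n) x) powr p"] show ?case
          using \<rho>0 by (simp add: field_simps)
      qed
    qed (use int in auto)
    finally show ?thesis by (simp add: mult_left_mono)
  qed
  \<comment> \<open>The comparison is used twice, for u against \<phi> n in the Hardy weight and for
    grad (\<phi> n) against G in the weight \<rho>; hence the factor appears squared.\<close>
  have le: "?U \<le> (1 - l) powr (1 - p) * (?K * ((1 - l) powr (1 - p) * ?R))" if l: "0 < l" "l < 1" for l
  proof -
    define k k' where "k = (1 - l) powr (1 - p)" and "k' = l powr (1 - p)"
    have "?U \<le> k * (?K * (k * ?R + k' * d n)) + k' * e n" for n
    proof -
      have "?U \<le> k * (\<integral>x. ?w x * norm (\<phi> n x) powr p \<partial>half_leb) + k' * e n"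
        using integral_wLp_le[OF weight_fun_powr p(1) u C_delta_wLp(1)[OF weight_fun_powr _ \<phi>] l] p
        by (simp add: k_def k'_def e_def abs_minus_commute)
      also have "k * (\<integral>x. ?w x * norm (\<phi> n x) powr p \<partial>half_leb) \<le> k * (?K * (k * ?R + k' * d n))"
      proof (rule mult_left_mono[OF order_trans[OF hardy mult_left_mono[OF _ K]]])
        show "(\<integral>x. \<rho> x * norm (grad (\<phi> n) x) powr p \<partial>half_leb) \<le> k * ?R + k' * d n"
          using integral_wLp_le[OF \<rho> p(1) C_delta_wLp(2)[OF \<rho> _ \<phi>] G l] p
          by (simp add: k_def k'_def d_def)
      qed (simp add: k_def)
      finally show ?thesis by simp
    qed
    \<comment> \<open>Here l is fixed, so \<open>k'\<close> is a constant and both error terms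
      disappear.\<close>
    moreover have "(\<lambda>n. k * (?K * (k * ?R + k' * d n)) + k' * e n) \<longlonglongrightarrow> k * (?K * (k * ?R + k' * 0)) + k' * 0"
      by (intro tendsto_intros d e)
    ultimately have "?U \<le> k * (?K * (k * ?R + k' * 0)) + k' * 0"
      by (intro LIMSEQ_le_const) auto
    then show ?thesis by (simp add: k_def)
  qed
  \<comment> \<open>Letting l decrease to 0 recovers the sharp constant.\<close>
  have "((\<lambda>l. (1 - l) powr (1 - p) * (?K * ((1 - l) powr (1 - p) * ?R))) \<longlongrightarrow>
      (1 - 0) powr (1 - p) * (?K * ((1 - 0) powr (1 - p) * ?R))) (at_right 0)"
    by (intro tendsto_intros) auto
  moreover have "\<forall>\<^sub>F l in at_right (0::real). ?U \<le> (1 - l) powr (1 - p) * (?K * ((1 - l) powr (1 - p) * ?R))"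
    using le by (intro eventually_at_rightI[of 0 1]) auto
  ultimately show ?thesis
    using tendsto_lowerbound[of _ _ "at_right (0::real)" ?U] by fastforce
qed

section \<open>The energy identity\<close>

text \<open>Transfers control from the Hardy weight, where u and the errors \<phi> n - u are
  measured, to the coefficient \<open>b\<close>.\<close>

lemma wLp_integrable_mult:
  assumes w: "weight_fun w" and b: "weight_fun b"
    and le: "AE x in half_leb. b x \<le> K * w x" and f: "f \<in> wLp p w"
  shows "integrable half_leb (\<lambda>x. b x * norm (f x) powr p)"
    "(\<integral>x. b x * norm (f x) powr p \<partial>half_leb) \<le> K * (\<integral>x. w x * norm (f x) powr p \<partial>half_leb)"
proof -
  have [measurable]: "b \<in> borel_measurable half_leb" "f \<in> borel_measurable half_leb"
    using weight_fun_measurable[OF b] f by (auto simp: wLp_def)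
  have int: "integrable half_leb (\<lambda>x. K * (w x * norm (f x) powr p))" using f by (auto simp: wLp_def)
  have AE: "AE x in half_leb. 0 \<le> b x * norm (f x) powr p \<and> b x * norm (f x) powr p \<le> K * (w x * norm (f x) powr p)"
    using le weight_fun_nonneg[OF b]
  proof eventually_elim
    case (elim x)
    from mult_right_mono[OF elim(1), of "norm (f x) powr p"] elim(2) show ?case by (simp add: mult.assoc)
  qed
  show b': "integrable half_leb (\<lambda>x. b x * norm (f x) powr p)"
    by (rule Bochner_Integration.integrable_bound[OF int]) (use AE in \<open>auto elim: eventually_mono\<close>)
  have "(\<integral>x. b x * norm (f x) powr p \<partial>half_leb) \<le> (\<integral>x. K * (w x * norm (f x) powr p) \<partial>half_leb)"
    by (rule integral_mono_AE[OF b' int]) (use AE in \<open>auto elim: eventually_mono\<close>)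
  then show "(\<integral>x. b x * norm (f x) powr p \<partial>half_leb) \<le> K * (\<integral>x. w x * norm (f x) powr p \<partial>half_leb)"
    using f by (simp add: wLp_def)
qed

text \<open>Each side of the equation tested with \<phi> n is its expected limit plus an error
  linear in grad (\<phi> n) - G or in \<phi> n - u; both errors vanish by
  \<open>pairing_tendsto_0\<close>.\<close>

lemma energy_identity:
  fixes \<rho> a b u :: "('m::finite) pt \<Rightarrow> real"
  assumes exps: "1 < s" "s < q" "q < p"
    and weights: "weight_fun \<rho>" "weight_fun a" "weight_fun b"
    and b_int: "integrable half_leb b"
    and b_le: "AE x in half_leb. b x \<le> K * (1 + snd x) powr (\<gamma> - p)"
    and A: "0 \<le> A" "AE x in half_leb. a x \<le> A * b x"
    and E: "(u, G) \<in> space_E \<rho> p \<gamma>"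
    and weak: "\<And>\<phi>. \<phi> \<in> C_delta \<Longrightarrow>
      (\<integral>x. \<rho> x * norm (G x) powr (p - 2) * (G x \<bullet> grad \<phi> x) \<partial>half_leb) =
      (\<integral>x. (a x * \<bar>u x\<bar> powr (q - 2) * u x - b x * \<bar>u x\<bar> powr (s - 2) * u x) * \<phi> x \<partial>half_leb)"
  shows "integrable half_leb (\<lambda>x. a x * \<bar>u x\<bar> powr q - b x * \<bar>u x\<bar> powr s)"
    "(\<integral>x. \<rho> x * norm (G x) powr p \<partial>half_leb) = (\<integral>x. a x * \<bar>u x\<bar> powr q - b x * \<bar>u x\<bar> powr s \<partial>half_leb)"
proof -
  let ?w = "\<lambda>x :: 'm pt. (1 + snd x) powr (\<gamma> - p)"
  have p: "1 < p" using exps by simp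
  obtain \<phi> where \<phi>: "\<And>n. \<phi> n \<in> C_delta"
    and limG: "(\<lambda>n. wnorm p \<rho> (\<lambda>x. grad (\<phi> n) x - G x)) \<longlonglongrightarrow> 0"
    and limu: "(\<lambda>n. wnorm p ?w (\<lambda>x. \<phi> n x - u x)) \<longlonglongrightarrow> 0"
    using E by (auto simp: space_E_def)
  have u: "u \<in> wLp p ?w" and G: "G \<in> wLp p \<rho>" using E by (auto simp: space_E_def)
  have \<phi>u: "(\<lambda>x. \<phi> n x - u x) \<in> wLp p ?w" for n
    using wLp_diff[OF weight_fun_powr p C_delta_wLp(1)[OF weight_fun_powr _ \<phi>] u] p by simp
  have \<phi>G: "(\<lambda>x. grad (\<phi> n) x - G x) \<in> wLp p \<rho>" for n
    using wLp_diff[OF weights(1) p C_delta_wLp(2)[OF weights(1) _ \<phi>] G] p by simp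
  have [measurable]: "u \<in> borel_measurable half_leb" "G \<in> borel_measurable half_leb"
    "\<rho> \<in> borel_measurable half_leb" "a \<in> borel_measurable half_leb" "b \<in> borel_measurable half_leb"
    "\<And>n. \<phi> n \<in> borel_measurable half_leb" "\<And>n. grad (\<phi> n) \<in> borel_measurable half_leb"
    using u G weights C_delta_wLp[OF weights(1) _ \<phi>, of p] p by (auto simp: weight_fun_measurable wLp_def)

  \<comment> \<open>Error on the gradient side. Cauchy-Schwarz gives it the form required for the
    pairing, with X = |G| and weight \<rho>.\<close>
  define h where "h n x = \<rho> x * norm (G x) powr (p - 2) * (G x \<bullet> (grad (\<phi> n) x - G x))" for n x
  have h: "integrable half_leb (h n)" "(\<lambda>n. \<integral>x. h n x \<partial>half_leb) \<longlonglongrightarrow> 0" for n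
  proof -
    have "AE x in half_leb. \<bar>h n x\<bar> \<le> 1 * (\<rho> x * (norm (G x) powr (p - 1) * norm (grad (\<phi> n) x - G x)))" for n
      using weight_fun_nonneg[OF weights(1)]
    proof eventually_elim
      case (elim x)
      have "\<bar>h n x\<bar> = \<rho> x * norm (G x) powr (p - 2) * \<bar>G x \<bullet> (grad (\<phi> n) x - G x)\<bar>"
        using elim by (simp add: h_def abs_mult)
      also have "\<dots> \<le> \<rho> x * norm (G x) powr (p - 2) * (norm (G x) * norm (grad (\<phi> n) x - G x))"
        using elim by (intro mult_left_mono Cauchy_Schwarz_ineq2) auto
      also have "\<dots> = \<rho> x * ((norm (G x) powr (p - 2) * norm (G x)) * norm (grad (\<phi> n) x - G x))"
        by (simp only: mult_ac)
      finally show ?case by (simp add: powr_mult_self)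
    qed
    note * = pairing_tendsto_0[OF p weight_fun_nonneg[OF weights(1)] _ _ _ this]
    show "integrable half_leb (h n)" for n
      by (rule *(1)) (use G \<phi>G wnorm_tendsto_0D[OF weights(1) _ limG] p in \<open>auto simp: wLp_def h_def\<close>)
    show "(\<lambda>n. \<integral>x. h n x \<partial>half_leb) \<longlonglongrightarrow> 0"
      by (rule *(2)) (use G \<phi>G wnorm_tendsto_0D[OF weights(1) _ limG] p in \<open>auto simp: wLp_def h_def\<close>)
  qed

  define F where "F x = a x * \<bar>u x\<bar> powr (q - 2) * u x - b x * \<bar>u x\<bar> powr (s - 2) * u x" for x
  \<comment> \<open>The base 1 + |u| is at least 1, so raising the exponents q - 1 and s - 1 to p -
    1 only increases the bound; \<open>a\<close> is replaced by A b.\<close>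
  have F_le: "AE x in half_leb. \<bar>F x\<bar> \<le> (A + 1) * (b x * (1 + \<bar>u x\<bar>) powr (p - 1))"
    using weight_fun_nonneg[OF weights(2)] weight_fun_nonneg[OF weights(3)] A(2)
  proof eventually_elim
    case (elim x)
    have pw: "\<bar>\<bar>u x\<bar> powr (r - 2) * u x\<bar> \<le> (1 + \<bar>u x\<bar>) powr (p - 1)" if "1 < r" "r < p" for r
    proof -
      have "\<bar>\<bar>u x\<bar> powr (r - 2) * u x\<bar> = \<bar>u x\<bar> powr (r - 1)"
        using powr_mult_self[of "\<bar>u x\<bar>" "r - 2"] by (simp add: abs_mult)
      also have "\<dots> \<le> (1 + \<bar>u x\<bar>) powr (r - 1)" using that by (intro powr_mono2) auto
      also have "\<dots> \<le> (1 + \<bar>u x\<bar>) powr (p - 1)" using that by (intro powr_mono) auto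
      finally show ?thesis .
    qed
    have "\<bar>F x\<bar> \<le> \<bar>a x * (\<bar>u x\<bar> powr (q - 2) * u x)\<bar> + \<bar>b x * (\<bar>u x\<bar> powr (s - 2) * u x)\<bar>"
      unfolding F_def mult.assoc by (rule abs_triangle_ineq4)
    also have "\<dots> = a x * \<bar>\<bar>u x\<bar> powr (q - 2) * u x\<bar> + b x * \<bar>\<bar>u x\<bar> powr (s - 2) * u x\<bar>"
      using elim by (simp add: abs_mult)
    also have "\<dots> \<le> (A * b x) * (1 + \<bar>u x\<bar>) powr (p - 1) + b x * (1 + \<bar>u x\<bar>) powr (p - 1)"
      using elim exps A by (intro add_mono mult_mono pw) auto
    finally show ?case by (simp add: algebra_simps)
  qed
  have b1: "integrable half_leb (\<lambda>x. b x * (1 + \<bar>u x\<bar>) powr p)"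
  proof (rule Bochner_Integration.integrable_bound)
    show "integrable half_leb (\<lambda>x. (1 / 2) powr (1 - p) * b x + (1 / 2) powr (1 - p) * (b x * \<bar>u x\<bar> powr p))"
      using b_int wLp_integrable_mult(1)[OF weight_fun_powr weights(3) b_le u] by auto
    show "AE x in half_leb. norm (b x * (1 + \<bar>u x\<bar>) powr p)
        \<le> norm ((1 / 2) powr (1 - p) * b x + (1 / 2) powr (1 - p) * (b x * \<bar>u x\<bar> powr p))"
      using weight_fun_nonneg[OF weights(3)]
    proof eventually_elim
      case (elim x)
      have "(1 + \<bar>u x\<bar>) powr p \<le> (1 / 2) powr (1 - p) + (1 / 2) powr (1 - p) * \<bar>u x\<bar> powr p"
        using add_powr_le[of "1 / 2" p 1 "\<bar>u x\<bar>"] p by simp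
      from mult_left_mono[OF this elim] elim show ?case by (simp add: algebra_simps)
    qed
  qed measurable
  have Fu: "F x * u x = a x * \<bar>u x\<bar> powr q - b x * \<bar>u x\<bar> powr s" for x
  proof -
    have "\<bar>u x\<bar> powr (r - 2) * (u x * u x) = \<bar>u x\<bar> powr r" for r
      using powr_mult_square[of "\<bar>u x\<bar>" r] by simp
    then show ?thesis by (simp add: F_def left_diff_distrib mult.assoc)
  qed
  have [measurable]: "F \<in> borel_measurable half_leb" unfolding F_def by measurable
  have Fu_int: "integrable half_leb (\<lambda>x. F x * u x)"
  proof (rule Bochner_Integration.integrable_bound)
    show "integrable half_leb (\<lambda>x. (A + 1) * (b x * (1 + \<bar>u x\<bar>) powr p))" using b1 by simp
    show "AE x in half_leb. norm (F x * u x) \<le> norm ((A + 1) * (b x * (1 + \<bar>u x\<bar>) powr p))"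
      using F_le weight_fun_nonneg[OF weights(3)]
    proof eventually_elim
      case (elim x)
      have "\<bar>F x\<bar> * \<bar>u x\<bar> \<le> (A + 1) * (b x * (1 + \<bar>u x\<bar>) powr (p - 1)) * (1 + \<bar>u x\<bar>)"
        using elim A by (intro mult_mono) auto
      also have "\<dots> = (A + 1) * (b x * (1 + \<bar>u x\<bar>) powr p)"
        using powr_mult_self[of "1 + \<bar>u x\<bar>" "p - 1"] by (simp only: mult.assoc) simp
      finally show ?case using elim A by (simp add: abs_mult)
    qed
  qed measurable
  then show "integrable half_leb (\<lambda>x. a x * \<bar>u x\<bar> powr q - b x * \<bar>u x\<bar> powr s)" by (simp add: Fu)

  \<comment> \<open>Error on the source side, paired in the weight \<open>b\<close> with X = 1 +
    |u|.\<close>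
  define k where "k n x = F x * (\<phi> n x - u x)" for n x
  have k: "integrable half_leb (k n)" "(\<lambda>n. \<integral>x. k n x \<partial>half_leb) \<longlonglongrightarrow> 0" for n
  proof -
    have le: "AE x in half_leb. \<bar>k n x\<bar> \<le> (A + 1) * (b x * ((1 + \<bar>u x\<bar>) powr (p - 1) * \<bar>\<phi> n x - u x\<bar>))" for n
      using F_le
    proof eventually_elim
      case (elim x)
      from mult_right_mono[OF elim, of "\<bar>\<phi> n x - u x\<bar>"] show ?case by (simp add: k_def abs_mult mult.assoc)
    qed
    note bd = wLp_integrable_mult[OF weight_fun_powr weights(3) b_le \<phi>u]
    have "(\<lambda>n. \<integral>x. b x * \<bar>\<phi> n x - u x\<bar> powr p \<partial>half_leb) \<longlonglongrightarrow> 0"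
    proof (rule tendsto_sandwich[of "\<lambda>_. 0"])
      show "(\<lambda>n. K * (\<integral>x. ?w x * norm (\<phi> n x - u x) powr p \<partial>half_leb)) \<longlonglongrightarrow> 0"
        using wnorm_tendsto_0D[OF weight_fun_powr _ limu] p by (intro tendsto_mult_right_zero) auto
      show "\<forall>\<^sub>F n in sequentially. 0 \<le> (\<integral>x. b x * \<bar>\<phi> n x - u x\<bar> powr p \<partial>half_leb)"
      proof (rule always_eventually, intro allI integral_nonneg_AE)
        fix n show "AE x in half_leb. 0 \<le> b x * \<bar>\<phi> n x - u x\<bar> powr p"
          using weight_fun_nonneg[OF weights(3)] by (auto elim: eventually_mono)
      qed
    qed (use bd(2) in auto)
    note * = pairing_tendsto_0[OF p weight_fun_nonneg[OF weights(3)] _ _ _ le _ b1 _ this]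
    show "integrable half_leb (k n)" for n
      by (rule *(1)) (use bd(1) A in \<open>auto simp: k_def\<close>)
    show "(\<lambda>n. \<integral>x. k n x \<partial>half_leb) \<longlonglongrightarrow> 0"
      by (rule *(2)) (use bd(1) A in \<open>auto simp: k_def\<close>)
  qed

  have "(\<integral>x. h n x \<partial>half_leb) + (\<integral>x. \<rho> x * norm (G x) powr p \<partial>half_leb)
      = (\<integral>x. k n x \<partial>half_leb) + (\<integral>x. F x * u x \<partial>half_leb)" for n
  proof -
    have "norm (G x) powr (p - 2) * (G x \<bullet> G x) = norm (G x) powr p" for x
      using powr_mult_square[of "norm (G x)" p] by (simp add: dot_square_norm power2_eq_square)
    then have "h n x + \<rho> x * norm (G x) powr p = \<rho> x * norm (G x) powr (p - 2) * (G x \<bullet> grad (\<phi> n) x)" for x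
      by (simp add: h_def inner_diff_right right_diff_distrib mult.assoc)
    moreover have "k n x + F x * u x = F x * \<phi> n x" for x by (simp add: k_def algebra_simps)
    moreover have "integrable half_leb (\<lambda>x. \<rho> x * norm (G x) powr p)" using G by (simp add: wLp_def)
    ultimately show ?thesis
      using weak[OF \<phi>[of n]] h(1)[of n] k(1)[of n] Fu_int
      by (simp add: F_def flip: Bochner_Integration.integral_add)
  qed
  moreover have "(\<lambda>n. (\<integral>x. h n x \<partial>half_leb) + (\<integral>x. \<rho> x * norm (G x) powr p \<partial>half_leb))
      \<longlonglongrightarrow> 0 + (\<integral>x. \<rho> x * norm (G x) powr p \<partial>half_leb)"
    by (intro tendsto_intros h)
  moreover have "(\<lambda>n. (\<integral>x. k n x \<partial>half_leb) + (\<integral>x. F x * u x \<partial>half_leb)) \<longlonglongrightarrow> 0 + (\<integral>x. F x * u x \<partial>half_leb)"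
    by (intro tendsto_intros k)
  ultimately show "(\<integral>x. \<rho> x * norm (G x) powr p \<partial>half_leb) = (\<integral>x. a x * \<bar>u x\<bar> powr q - b x * \<bar>u x\<bar> powr s \<partial>half_leb)"
    using LIMSEQ_unique by (fastforce simp: Fu)
qed

section \<open>The trivial solution and its uniqueness\<close>

lemma Ck_zero: "Ck k (\<lambda>_. 0)"
  by (induction k) auto

lemma zero_C_delta: "(\<lambda>_. 0) \<in> C_delta"
  unfolding C_delta_def Cc_infty_def smooth_def by (auto intro!: exI[of _ "\<lambda>_. 0"] Ck_zero)

lemma weak_solution_zero: "weak_solution p q s \<gamma> \<rho> a b (\<lambda>_. 0)"
proof -
  have "((\<lambda>_. 0), (\<lambda>_. 0)) \<in> space_E \<rho> p \<gamma>"
    unfolding space_E_def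
    by (auto simp: wLp_def weak_gradient_def loc_integrable_def set_integrable_def wnorm_def
        intro!: exI[of _ "\<lambda>_ _. 0"] zero_C_delta)
  then show ?thesis
    unfolding weak_solution_def by (intro exI[of _ "\<lambda>_. 0"]) simp
qed

theorem theorem2p1:
  fixes \<rho> a b :: "(real ^ 'm::finite) \<times> real \<Rightarrow> real"
    and p q s \<gamma> \<rho>\<^sub>0 b\<^sub>0 :: real
  assumes exponents: "1 < s" "s < q" "q < p" "p \<le> real DIM((real ^ 'm) \<times> real)"
    and weights: "weight_fun \<rho>" "weight_fun a" "weight_fun b"
    and rho_lower: "0 < \<rho>\<^sub>0" "p - 1 < \<gamma>"
          "AE x in lebesgue_on halfspace. \<rho>\<^sub>0 * (1 + snd x) powr \<gamma> \<le> \<rho> x"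
    and b_class: "b \<in> K_b p \<gamma>" "integrable (lebesgue_on halfspace) b"
    and b_upper: "0 < b\<^sub>0" "\<forall>x\<in>halfspace. b x * (1 + snd x) powr (p - \<gamma>) \<le> b\<^sub>0"
    and ab_bounded: "in_Linfty (lebesgue_on halfspace) (\<lambda>x. a x / b x)"
    and small:
      "real_of_ereal (Linfty_norm (lebesgue_on halfspace) (\<lambda>x. a x / b x)) powr (p - s)
         * (b\<^sub>0 * ((\<gamma> - p + 1) / p) powr (- p) / \<rho>\<^sub>0) powr (q - s)
       < (p - s) powr (p - s) / ((q - s) powr (q - s) * (p - q) powr (p - q))"
  shows "weak_solution p q s \<gamma> \<rho> a b (\<lambda>_. 0) \<and>
    (\<forall>u. weak_solution p q s \<gamma> \<rho> a b u \<longrightarrow> (AE x in lebesgue_on halfspace. u x = 0))"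
proof (intro conjI weak_solution_zero allI impI)
  fix u assume "weak_solution p q s \<gamma> \<rho> a b u"
  then obtain G where E: "(u, G) \<in> space_E \<rho> p \<gamma>"
    and weak: "\<And>\<phi>. \<phi> \<in> C_delta \<Longrightarrow>
      (\<integral>x. \<rho> x * norm (G x) powr (p - 2) * (G x \<bullet> grad \<phi> x) \<partial>half_leb) =
      (\<integral>x. (a x * \<bar>u x\<bar> powr (q - 2) * u x - b x * \<bar>u x\<bar> powr (s - 2) * u x) * \<phi> x \<partial>half_leb)"
    unfolding weak_solution_def by blast
  let ?w = "\<lambda>x :: (real ^ 'm) \<times> real. (1 + snd x) powr (\<gamma> - p)"
  define L where "L = Linfty_norm half_leb (\<lambda>x. a x / b x)"
  define A where "A = real_of_ereal L"
  have p: "1 < p" using exponents by simp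
  have a_le: "AE x in half_leb. \<bar>a x / b x\<bar> \<le> A \<and> a x \<le> A * b x"
    using esssup_AE[of "\<lambda>x. ereal \<bar>a x / b x\<bar>" half_leb] weights(3)[unfolded weight_fun_def, THEN conjunct1]
  proof eventually_elim
    case (elim x)
    have "L < \<infinity>" using ab_bounded by (simp add: in_Linfty_def L_def)
    moreover have "ereal \<bar>a x / b x\<bar> \<le> L" using elim(1) by (simp add: L_def Linfty_norm_def)
    ultimately have "\<bar>a x / b x\<bar> \<le> A" by (cases L) (auto simp: A_def)
    then show ?case using elim(2) by (auto simp: field_simps abs_le_iff)
  qed
  show "AE x in half_leb. u x = 0"
  \<comment> \<open>For A < 0 the bound |a/b| \<le> A fails at every point, so the almost everywhere
    claim is vacuous; this spares a proof that the half-space is not a null set.\<close>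
  proof (cases "0 \<le> A")
    case False
    from a_le show ?thesis by eventually_elim (use False in linarith)
  next
    case A: True
    define \<Lambda> where "\<Lambda> = absorption_const A s q p"
    have \<Lambda>: "0 \<le> \<Lambda>" by (simp add: \<Lambda>_def absorption_const_def Let_def)
    define I where "I = (\<integral>x. \<rho> x * norm (G x) powr p \<partial>half_leb)"
    define k where "k = ((\<gamma> - p + 1) / p) powr (- p) / \<rho>\<^sub>0"
    have k: "0 \<le> k" using rho_lower by (simp add: k_def)
    have u: "u \<in> wLp p ?w" using E by (simp add: space_E_def)
    define U where "U = (\<integral>x. ?w x * norm (u x) powr p \<partial>half_leb)"
    have U: "U \<le> k * I"
      unfolding U_def k_def I_def by (rule hardy_space_E[OF p rho_lower(2) weights(1) rho_lower(1,3) E])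
    have b_le: "AE x in half_leb. b x \<le> b\<^sub>0 * ?w x"
    proof (rule AE_half_lebI)
      fix x :: "(real ^ 'm) \<times> real" assume x: "x \<in> halfspace"
      then have pos: "0 < 1 + snd x" by (simp add: halfspace_def)
      then have "(1 + snd x) powr (p - \<gamma>) * ?w x = 1" by (simp flip: powr_add)
      then show "b x \<le> b\<^sub>0 * ?w x"
        using mult_right_mono[OF b_upper(2)[rule_format, OF x], of "?w x"] by (simp add: mult.assoc)
    qed
    have a_le': "AE x in half_leb. a x \<le> A * b x" using a_le by (auto elim: eventually_mono)
    note energy = energy_identity[OF exponents(1-3) weights b_class(2) b_le A a_le' E weak]
    note bu = wLp_integrable_mult[OF weight_fun_powr weights(3) b_le u]
    have "I = (\<integral>x. a x * \<bar>u x\<bar> powr q - b x * \<bar>u x\<bar> powr s \<partial>half_leb)"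
      unfolding I_def by (rule energy(2))
    also have "\<dots> \<le> (\<integral>x. \<Lambda> * (b x * norm (u x) powr p) \<partial>half_leb)"
    proof (rule integral_mono_AE[OF energy(1)])
      show "AE x in half_leb. a x * \<bar>u x\<bar> powr q - b x * \<bar>u x\<bar> powr s \<le> \<Lambda> * (b x * norm (u x) powr p)"
        using a_le' weight_fun_nonneg[OF weights(3)]
      proof eventually_elim
        case (elim x)
        have "a x * \<bar>u x\<bar> powr q - b x * \<bar>u x\<bar> powr s \<le> (A * b x) * \<bar>u x\<bar> powr q - b x * \<bar>u x\<bar> powr s"
          using elim by (intro diff_right_mono mult_right_mono) auto
        also have "\<dots> = b x * (A * \<bar>u x\<bar> powr q - \<bar>u x\<bar> powr s)" by (simp add: algebra_simps)
        also have "\<dots> \<le> b x * (\<Lambda> * \<bar>u x\<bar> powr p)"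
          unfolding \<Lambda>_def using elim exponents A by (intro mult_left_mono absorption_le) auto
        finally show ?case by (simp add: mult.left_commute)
      qed
    qed (use bu in auto)
    also have "\<dots> \<le> \<Lambda> * (b\<^sub>0 * U)"
      using bu \<Lambda> by (simp add: U_def mult_left_mono)
    also have "\<dots> \<le> \<Lambda> * (b\<^sub>0 * (k * I))"
      using U \<Lambda> b_upper(1) by (intro mult_left_mono) auto
    finally have "I \<le> (\<Lambda> * (b\<^sub>0 * k)) * I" by (simp add: mult.assoc)
    moreover have "\<Lambda> * (b\<^sub>0 * k) < 1"
      unfolding \<Lambda>_def using exponents A mult_nonneg_nonneg[OF less_imp_le[OF b_upper(1)] k] small
      by (intro absorption_const_mult_less_1) (auto simp: A_def L_def k_def)
    \<comment> \<open>If I were positive, multiplying the factor below 1 by I would give I <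
      I.\<close>
    ultimately have "I \<le> 0"
      using mult_strict_right_mono[of "\<Lambda> * (b\<^sub>0 * k)" 1 I] by linarith
    then have "U \<le> 0" using U k mult_nonneg_nonpos[of k I] by linarith
    moreover have nn: "AE x in half_leb. 0 \<le> ?w x * norm (u x) powr p" by simp
    then have "0 \<le> U" unfolding U_def by (rule integral_nonneg_AE)
    ultimately have "U = 0" by simp
    then have "AE x in half_leb. ?w x * norm (u x) powr p = 0"
      using integral_nonneg_eq_0_iff_AE[OF _ nn] u by (simp add: U_def wLp_def)
    moreover have "AE x in half_leb. 0 < ?w x"
      using weight_fun_powr unfolding weight_fun_def by blast
    ultimately show ?thesis by eventually_elim (auto simp: norm_eq_zero)
  qed
qed

end
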